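(* Let $p$ be a prime, let $G=UT(4,p)$, and let $$\mathcal L_0^*=\{(a,b,c,0,e,f):(a,f)\in \mathbb F_p^2\setminus\{(0,0)\},\ b,c,e\in\mathbb F_p\}\subset G.$$ Then $\alpha\bigl(\Gamma[\mathcal L_0^*]\bigr)\le p^2$.
   Context: For a prime $p$, $UT(4,p)$ is the group, under matrix multiplication, of all $4\times 4$ upper triangular matrices over $\mathbb{F}_p$ with all diagonal entries equal to $1$. The $6$-tuple $(a,b,c,d,e,f)\in\mathbb{F}_p^6$ denotes the matrix $\begin{pmatrix}1&a&b&c\\0&1&d&e\\0&0&1&f\\0&0&0&1\end{pmatrix}$. The commuting graph $\Gamma(G)$ has vertex set $G$, two distinct vertices $x,y$ being adjacent if and only if $xy=yx$. For a subset $S\subseteq G$, $\Gamma[S]$ denotes the subgraph of $\Gamma(G)$ induced on $S$. The independence number $\alpha$ of a graph is the maximum size of a set of pairwise nonadjacent vertices. *)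

theory Defs
  imports
    "Jordan_Normal_Form.Matrix"
    "Berlekamp_Zassenhaus.Finite_Field"
    "Graph_Theory.Digraph_Component"
begin

text \<open>
  The field of \<open>p\<close> elements is the type \<open>'p mod_ring\<close>, where the sort \<open>'p :: prime_card\<close>
  says that \<open>p = CARD('p)\<close> is prime.
\<close>

definition UT4 :: "'p::prime_card mod_ring mat monoid" where
  "UT4 = \<lparr>carrier = {A \<in> carrier_mat 4 4. upper_triangular A \<and> (\<forall>i<4. A $$ (i, i) = 1)},
          monoid.mult = (*), one = 1\<^sub>m 4\<rparr>"

definition tup :: "'p::prime_card mod_ring \<Rightarrow> 'p mod_ring \<Rightarrow> 'p mod_ring \<Rightarrow> 'p mod_ring \<Rightarrow>
    'p mod_ring \<Rightarrow> 'p mod_ring \<Rightarrow> 'p mod_ring mat" where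
  "tup a b c d e f = mat_of_rows_list 4
    [[1, a, b, c],
     [0, 1, d, e],
     [0, 0, 1, f],
     [0, 0, 0, 1]]"

definition L0_star :: "'p::prime_card mod_ring mat set" where
  "L0_star = {tup a b c 0 e f | a b c e f. (a, f) \<noteq> (0, 0)}"

text \<open>
  An undirected edge \<open>{x, y}\<close> is represented by the two arcs \<open>(x, y)\<close> and \<open>(y, x)\<close>.
\<close>

definition commuting_graph :: "('a, 'm) monoid_scheme \<Rightarrow> ('a, 'a \<times> 'a) pre_digraph" where
  "commuting_graph G = \<lparr>verts = carrier G,
     arcs = {(x, y). x \<in> carrier G \<and> y \<in> carrier G \<and> x \<noteq> y \<and> x \<otimes>\<^bsub>G\<^esub> y = y \<otimes>\<^bsub>G\<^esub> x},
     tail = fst, head = snd\<rparr>"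

definition independent_set :: "('a, 'b) pre_digraph \<Rightarrow> 'a set \<Rightarrow> bool" where
  "independent_set \<Gamma> I \<longleftrightarrow> I \<subseteq> verts \<Gamma> \<and> (\<forall>x\<in>I. \<forall>y\<in>I. x \<noteq> y \<longrightarrow> (x, y) \<notin> arcs_ends \<Gamma>)"

text \<open>
  The maximum is meaningful for finite graphs only.
\<close>

definition independence_number :: "('a, 'b) pre_digraph \<Rightarrow> nat" where
  "independence_number \<Gamma> = Max {card I | I. independent_set \<Gamma> I}"

lemma independence_number_le_iff:
  assumes "finite (verts \<Gamma>)"
  shows "independence_number \<Gamma> \<le> n \<longleftrightarrow> (\<forall>I. independent_set \<Gamma> I \<longrightarrow> card I \<le> n)"
proof -
  have "{card I | I. independent_set \<Gamma> I} \<subseteq> card ` Pow (verts \<Gamma>)"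
    by (auto simp: independent_set_def)
  then have "finite {card I | I. independent_set \<Gamma> I}"
    by (rule finite_subset) (simp add: assms)
  moreover have "independent_set \<Gamma> {}"
    by (simp add: independent_set_def)
  then have "{card I | I. independent_set \<Gamma> I} \<noteq> {}"
    by blast
  ultimately have "independence_number \<Gamma> \<le> n \<longleftrightarrow> (\<forall>k\<in>{card I | I. independent_set \<Gamma> I}. k \<le> n)"
    unfolding independence_number_def by (rule Max_le_iff)
  then show ?thesis
    by blast
qed

lemma tup_carrier_mat: "tup a b c d e f \<in> carrier_mat 4 4"
  by (rule carrier_matI) (simp_all add: tup_def mat_of_rows_list_def)

lemma tup_index:
  "tup a b c d e f $$ (0, 0) = 1" "tup a b c d e f $$ (0, Suc 0) = a"
  "tup a b c d e f $$ (0, 2) = b" "tup a b c d e f $$ (0, 3) = c"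
  "tup a b c d e f $$ (Suc 0, 0) = 0" "tup a b c d e f $$ (Suc 0, Suc 0) = 1"
  "tup a b c d e f $$ (Suc 0, 2) = d" "tup a b c d e f $$ (Suc 0, 3) = e"
  "tup a b c d e f $$ (2, 0) = 0" "tup a b c d e f $$ (2, Suc 0) = 0"
  "tup a b c d e f $$ (2, 2) = 1" "tup a b c d e f $$ (2, 3) = f"
  "tup a b c d e f $$ (3, 0) = 0" "tup a b c d e f $$ (3, Suc 0) = 0"
  "tup a b c d e f $$ (3, 2) = 0" "tup a b c d e f $$ (3, 3) = 1"
  "dim_row (tup a b c d e f) = 4" "dim_col (tup a b c d e f) = 4"
  by (simp_all add: tup_def mat_of_rows_list_def)

lemma eq_mat4I:
  assumes "A \<in> carrier_mat 4 4" "B \<in> carrier_mat 4 4"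
    and "\<And>i j. i \<in> {0, Suc 0, 2, 3} \<Longrightarrow> j \<in> {0, Suc 0, 2, 3} \<Longrightarrow> A $$ (i, j) = B $$ (i, j)"
  shows "A = B"
proof (rule eq_matI)
  fix i j assume "i < dim_row B" "j < dim_col B"
  then have "i \<in> {0, Suc 0, 2, 3}" "j \<in> {0, Suc 0, 2, 3}"
    using assms(2) by auto
  then show "A $$ (i, j) = B $$ (i, j)" by (rule assms(3))
qed (use assms in auto)

lemma carrier_UT4: "carrier UT4 = {tup a b c d e f | a b c d e f. True}"
proof (intro equalityI subsetI)
  fix A :: "'a mod_ring mat"
  assume A: "A \<in> carrier UT4"
  then have dim: "A \<in> carrier_mat 4 4" by (simp add: UT4_def)
  have lower: "A $$ (i, j) = 0" if "i < 4" "j < i" for i j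
    using A that by (auto simp: UT4_def upper_triangular_def)
  have diag: "A $$ (i, i) = 1" if "i < 4" for i
    using A that by (simp add: UT4_def)
  have "A = tup (A $$ (0, 1)) (A $$ (0, 2)) (A $$ (0, 3)) (A $$ (1, 2)) (A $$ (1, 3)) (A $$ (2, 3))"
    by (rule eq_mat4I[OF dim tup_carrier_mat]) (auto simp: tup_index lower diag)
  then show "A \<in> {tup a b c d e f | a b c d e f. True}"
    by blast
next
  fix A :: "'a mod_ring mat"
  assume "A \<in> {tup a b c d e f | a b c d e f. True}"
  then obtain a b c d e f where A: "A = tup a b c d e f"
    by blast
  have "A $$ (i, j) = 0" if "i < 4" "j < i" for i j
  proof -
    have "i = 1 \<and> j = 0 \<or> i = 2 \<and> j = 0 \<or> i = 2 \<and> j = 1 \<or>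
      i = 3 \<and> j = 0 \<or> i = 3 \<and> j = 1 \<or> i = 3 \<and> j = 2"
      using that by (auto simp: numeral_eq_Suc less_Suc_eq)
    then show ?thesis
      by (auto simp: A tup_index)
  qed
  moreover have "A $$ (i, i) = 1" if "i < 4" for i
  proof -
    have "i = 0 \<or> i = 1 \<or> i = 2 \<or> i = 3"
      using that by (auto simp: numeral_eq_Suc less_Suc_eq)
    then show ?thesis
      by (auto simp: A tup_index)
  qed
  ultimately show "A \<in> carrier UT4"
    using tup_carrier_mat[of a b c d e f] by (simp add: UT4_def upper_triangular_def A tup_index)
qed

lemma tup_mult:
  "tup a b c d e f * tup a' b' c' d' e' f' =
   tup (a + a') (b + b' + a * d') (c + c' + a * e' + b * f') (d + d') (e + e' + d * f') (f + f')"
proof (rule eq_mat4I[OF mult_carrier_mat[OF tup_carrier_mat tup_carrier_mat] tup_carrier_mat])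
  have *: "{0..<4::nat} = {0, Suc 0, 2, 3}"
    by auto
  fix i j :: nat
  assume "i \<in> {0, Suc 0, 2, 3}" "j \<in> {0, Suc 0, 2, 3}"
  then show "(tup a b c d e f * tup a' b' c' d' e' f') $$ (i, j) =
    tup (a + a') (b + b' + a * d') (c + c' + a * e' + b * f') (d + d') (e + e' + d * f') (f + f') $$ (i, j)"
    by (elim insertE emptyE; hypsubst; simp add: tup_index scalar_prod_def * algebra_simps)
qed

lemma tup_0: "tup 0 0 0 0 0 0 = 1\<^sub>m 4"
  by (rule eq_mat4I[OF tup_carrier_mat one_carrier_mat]) (auto simp: tup_index)

lemma group_UT4: "group (UT4 :: 'p::prime_card mod_ring mat monoid)"
proof (rule groupI)
  fix x :: "'p mod_ring mat"
  assume "x \<in> carrier UT4"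
  then obtain a b c d e f where x: "x = tup a b c d e f"
    by (auto simp: carrier_UT4)
  let ?y = "tup (- a) (a * d - b) (a * e + b * f - a * d * f - c) (- d) (d * f - e) (- f)"
  have "?y * x = 1\<^sub>m 4"
    unfolding x tup_mult tup_0[symmetric] by (simp add: algebra_simps)
  moreover have "?y \<in> carrier UT4"
    unfolding carrier_UT4 by blast
  ultimately show "\<exists>y\<in>carrier UT4. y \<otimes>\<^bsub>UT4\<^esub> x = \<one>\<^bsub>UT4\<^esub>"
    by (intro bexI[of _ ?y]) (simp_all add: UT4_def)
next
  fix x y :: "'p mod_ring mat"
  assume "x \<in> carrier UT4" "y \<in> carrier UT4"
  then obtain a b c d e f a' b' c' d' e' f'
    where xy: "x = tup a b c d e f" "y = tup a' b' c' d' e' f'"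
    unfolding carrier_UT4 by blast
  have "x * y \<in> carrier UT4"
    unfolding xy carrier_UT4 tup_mult by blast
  then show "x \<otimes>\<^bsub>UT4\<^esub> y \<in> carrier UT4"
    by (simp add: UT4_def)
next
  have "1\<^sub>m 4 \<in> carrier UT4"
    unfolding carrier_UT4 tup_0[symmetric] by blast
  then show "\<one>\<^bsub>UT4\<^esub> \<in> carrier UT4"
    by (simp add: UT4_def)
qed (auto simp: UT4_def)

lemma finite_carrier_UT4: "finite (carrier (UT4 :: 'p::prime_card mod_ring mat monoid))"
proof -
  have "carrier (UT4 :: 'p mod_ring mat monoid) \<subseteq> (\<lambda>(a, b, c, d, e, f). tup a b c d e f) ` UNIV"
  proof
    fix A :: "'p mod_ring mat"
    assume "A \<in> carrier UT4"
    then obtain a b c d e f where "A = tup a b c d e f"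
      unfolding carrier_UT4 by blast
    then show "A \<in> (\<lambda>(a, b, c, d, e, f). tup a b c d e f) ` UNIV"
      by (intro image_eqI[of _ _ "(a, b, c, d, e, f)"]) simp_all
  qed
  then show ?thesis
    by (rule finite_subset) simp
qed

lemma L0_star_subset: "L0_star \<subseteq> carrier UT4"
  unfolding L0_star_def carrier_UT4 by blast

end

theory Submission
  imports Defs
begin

text \<open>
  For \<open>d = 0\<close> the matrices \<open>(a, b, c, 0, e, f)\<close> and \<open>(a', b', c', 0, e', f')\<close> commute exactly if
  the alternating form \<open>a e' - a' e + b f' - b' f\<close> vanishes, so commuting is orthogonality in the
  symplectic space of the vectors \<open>(a, b, e, f)\<close>.  A totally isotropic subspace gives a
  clique, and a regular spread partitions the nonzero vectors into \<open>p\<^sup>2 + 1\<close>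
  totally isotropic planes.  The spread can be chosen to contain the plane \<open>a = f = 0\<close>, which is what
  \<open>L0_star\<close> leaves out.  The other \<open>p\<^sup>2\<close> planes are therefore cliques (\<open>spread_plane_commute\<close>) that cover
  \<open>L0_star\<close> (\<open>L0_star_covered\<close>), and an independent set meets each of them at most once.

  The \<open>p\<^sup>2\<close> planes are written as graphs over the coordinates \<open>(a, f)\<close>.  The graph of
  \<open>(a, f) \<mapsto> (e, - b)\<close> is isotropic exactly if the linear map has a symmetric matrix, and two graphs
  meet only in zero exactly if the difference of their matrices is invertible.  Hence the spread comes
  from a two-dimensional space of symmetric matrices on which the determinant vanishes only at zero.
  Such a space is obtained from a quadratic polynomial without roots
  (\<open>ex_quadratic_without_root\<close>).
\<close>

text \<open>
  The map \<open>x \<mapsto> x\<^sup>2 - x\<close> takes the value \<open>0\<close> at both \<open>0\<close> and \<open>1\<close>, so on a finite field it is not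
  onto. The linear term lets one polynomial serve every
  characteristic, whereas \<open>x\<^sup>2 - n\<close> always has a root in characteristic \<open>2\<close>.
\<close>

lemma ex_quadratic_without_root:
  "\<exists>n :: 'a :: {field, finite}. \<forall>x. x\<^sup>2 - x \<noteq> n"
proof (rule ccontr)
  assume "\<not> ?thesis"
  then have "\<forall>n :: 'a. \<exists>x. n = x\<^sup>2 - x"
    by metis
  then have "surj (\<lambda>x :: 'a. x\<^sup>2 - x)"
    unfolding surj_def .
  then have "inj (\<lambda>x :: 'a. x\<^sup>2 - x)"
    by (simp add: finite_UNIV_surj_inj)
  from injD[OF this, of 0 1] show False
    by simp
qed

text \<open>
  This is the homogeneous form of \<open>x\<^sup>2 - x - n\<close> at \<open>x = - a / f\<close>.
\<close>

lemma norm_form_nonzero: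
  fixes n a f :: "'a :: field"
  assumes n: "\<forall>x. x\<^sup>2 - x \<noteq> n" and af: "(a, f) \<noteq> (0, 0)"
  shows "a\<^sup>2 + a * f - n * f\<^sup>2 \<noteq> 0"
proof
  assume *: "a\<^sup>2 + a * f - n * f\<^sup>2 = 0"
  have "f \<noteq> 0"
    using * af by auto
  then have "(- a / f)\<^sup>2 - (- a / f) = (a\<^sup>2 + a * f) / f\<^sup>2"
    by (simp add: field_simps power2_eq_square)
  also have "\<dots> = n"
    using * \<open>f \<noteq> 0\<close> by (simp add: field_simps)
  finally show False
    using n by blast
qed

text \<open>
  The graph over \<open>(a, f)\<close> of the symmetric matrix with rows \<open>(r, s)\<close> and \<open>(s, n r + s)\<close>, with
  \<open>c\<close> left free. The determinant of this matrix is \<open>n r\<^sup>2 + r s - s\<^sup>2\<close>, which vanishes only at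
  \<open>r = s = 0\<close> if \<open>x\<^sup>2 - x - n\<close> has no root.
\<close>

definition spread_plane ::
  "'p::prime_card mod_ring \<Rightarrow> 'p mod_ring \<times> 'p mod_ring \<Rightarrow> 'p mod_ring mat set" where
  "spread_plane n = (\<lambda>(r, s). {tup a (- (s * a + (n * r + s) * f)) c 0 (r * a + s * f) f | a c f. True})"

text \<open>
  The symmetry of the matrix is what makes the alternating form vanish on the plane.
\<close>

lemma spread_plane_commute:
  assumes "x \<in> spread_plane n k" "y \<in> spread_plane n k"
  shows "x * y = y * x"
proof -
  obtain r s where k: "k = (r, s)"
    by (cases k)
  obtain a c f where x: "x = tup a (- (s * a + (n * r + s) * f)) c 0 (r * a + s * f) f"
    using assms(1) unfolding k spread_plane_def by blast
  obtain a' c' f' where y: "y = tup a' (- (s * a' + (n * r + s) * f')) c' 0 (r * a' + s * f') f'"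
    using assms(2) unfolding k spread_plane_def by blast
  show ?thesis
    unfolding x y tup_mult by (simp add: algebra_simps)
qed

text \<open>
  For fixed \<open>(a, f)\<close>, finding the plane through a given \<open>(b, e)\<close> is a linear system in \<open>(r, s)\<close>
  with determinant \<open>a\<^sup>2 + a f - n f\<^sup>2\<close>, which Cramer's rule solves.
\<close>

lemma L0_star_covered:
  fixes n :: "'p::prime_card mod_ring"
  assumes n: "\<forall>x. x\<^sup>2 - x \<noteq> n" and x: "x \<in> L0_star"
  shows "\<exists>k. x \<in> spread_plane n k"
proof -
  obtain a b c e f where x: "x = tup a b c 0 e f" and af: "(a, f) \<noteq> (0, 0)"
    using x unfolding L0_star_def by blast
  define D where "D = a\<^sup>2 + a * f - n * f\<^sup>2"
  have D: "D \<noteq> 0"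
    unfolding D_def using norm_form_nonzero[OF n af] .
  define r where "r = (e * (a + f) + b * f) / D"
  define s where "s = - (a * b + n * f * e) / D"
  have "r * a + s * f = e * D / D"
    unfolding r_def s_def times_divide_eq_left add_divide_distrib[symmetric]
    by (rule arg_cong[of _ _ "\<lambda>z. z / D"]) (simp add: D_def power2_eq_square algebra_simps)
  then have e: "r * a + s * f = e"
    using D by simp
  have "s * a + (n * r + s) * f = (- b) * D / D"
    unfolding r_def s_def times_divide_eq_left times_divide_eq_right add_divide_distrib[symmetric]
    by (rule arg_cong[of _ _ "\<lambda>z. z / D"]) (simp add: D_def power2_eq_square algebra_simps)
  then have "- (s * a + (n * r + s) * f) = b"
    using D by simp
  with e have "x = tup a (- (s * a + (n * r + s) * f)) c 0 (r * a + s * f) f"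
    by (simp only: x)
  then have "x \<in> spread_plane n (r, s)"
    unfolding spread_plane_def by blast
  then show ?thesis ..
qed

theorem corollary6p6:
  fixes p :: nat
  assumes "p = CARD('p::prime_card)"
  shows "independence_number
           (commuting_graph (UT4 :: 'p mod_ring mat monoid) \<restriction> L0_star) \<le> p\<^sup>2"
proof -
  let ?\<Gamma> = "commuting_graph (UT4 :: 'p mod_ring mat monoid) \<restriction> L0_star"
  obtain n :: "'p mod_ring" where n: "\<forall>x. x\<^sup>2 - x \<noteq> n"
    using ex_quadratic_without_root by blast
  have "finite (verts ?\<Gamma>)"
    using finite_subset[OF L0_star_subset finite_carrier_UT4] by simp
  moreover have "card I \<le> p\<^sup>2" if "independent_set ?\<Gamma> I" for I
  proof -
    have I: "I \<subseteq> L0_star"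
      using that by (simp add: independent_set_def)
    have eq: "x = y" if xy: "x \<in> I" "y \<in> I" and "x * y = y * x" for x y
    proof (rule ccontr)
      assume "x \<noteq> y"
      moreover have "x \<in> carrier UT4" "y \<in> carrier UT4"
        using xy I L0_star_subset by blast+
      ultimately have "(x, y) \<in> arcs_ends ?\<Gamma>"
        using xy I \<open>x * y = y * x\<close>
        by (auto simp: arcs_ends_def arc_to_ends_def commuting_graph_def induce_subgraph_def
            UT4_def image_iff)
      with \<open>x \<noteq> y\<close> xy \<open>independent_set ?\<Gamma> I\<close> show False
        by (auto simp: independent_set_def)
    qed
    obtain k where k: "\<And>x. x \<in> I \<Longrightarrow> x \<in> spread_plane n (k x)"
      using L0_star_covered[OF n] I by (metis subsetD)
    have "inj_on k I"
      by (rule inj_onI) (metis k eq spread_plane_commute)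
    then have "card I \<le> CARD('p mod_ring \<times> 'p mod_ring)"
      by (rule card_inj_on_le) auto
    also have "\<dots> = p\<^sup>2"
      using assms by (simp add: power2_eq_square)
    finally show ?thesis .
  qed
  ultimately show ?thesis
    by (simp add: independence_number_le_iff)
qed

end
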